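(* If $f(x)=\sum_{k=0}^{\infty} a_{2k}x^{2k}$, then $$\int_0^{\frac{\pi}{2}} f(\sin x)\,dx=\int_0^{\frac{\pi}{2}} f(\cos x)\,dx=\frac{\pi}{2}a_0+\frac{\pi}{2}\sum_{k=1}^{\infty} a_{2k}\,\frac{1\cdot 3\cdot\ldots\cdot(2k-1)}{2\cdot 4\cdot\ldots\cdot(2k)}.$$
   Context: Here $f$ is a function given by a power series in even powers of $x$ with coefficients $a_{2k}$, $k\ge 0$. $1\cdot 3\cdot\ldots\cdot(2k-1)$ denotes the product of the first $k$ odd positive integers and $2\cdot 4\cdot\ldots\cdot(2k)$ the product of the first $k$ even positive integers. *)

theory Defs
  imports "HOL-Analysis.Analysis"
begin

definition odd_product :: "nat \<Rightarrow> real" where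
  "odd_product k = (\<Prod>j = 1..k. 2 * real j - 1)"

definition even_product :: "nat \<Rightarrow> real" where
  "even_product k = (\<Prod>j = 1..k. 2 * real j)"

end

theory Submission imports Defs begin

text \<open>
  The formula comes from integrating the series term by term, since
  \<open>\<integral>\<^sub>0\<^bsup>\<pi>/2\<^esup> sin\<^bsup>2k\<^esup> x dx\<close> is \<open>\<pi>/2\<close> times the product of the first \<open>k\<close> odd numbers
  divided by that of the first \<open>k\<close> even ones (lemma \<open>wallis_integral_even\<close>, by the usual recursion in the exponent).

  The exchange of sum and integral needs an argument, because at \<open>x = \<pi>/2\<close> the series for
  \<open>f\<close> is evaluated at 1, which may be an end point of its interval of convergence. There it may
  converge only conditionally, so that no absolutely convergent majorant need exist. Abel's test
  (lemma \<open>Abel_test_uniform_limit\<close>) takes the place of a majorant: the coefficients form a convergent series,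
  the weights \<open>sin\<^bsup>2k\<^esup> x\<close> lie in \<open>[0,1]\<close> and decrease in \<open>k\<close>, hence the convergence is uniform in
  \<open>x\<close>. The uniform limit is integrable, and the integrals of the partial sums converge to its
  integral; this gives the value of the integral and the convergence of the series of
  integrals at once.

  The cosine version is the sine version reflected at the midpoint of \<open>[0, \<pi>/2]\<close>.
\<close>

text \<open>
  Summation by parts writes the weighted sum as a combination of the partial sums of \<open>d\<close> whose
  coefficients \<open>u k - u (Suc k)\<close> and \<open>u n\<close> are nonnegative and add up to \<open>u 0\<close>.
\<close>
lemma Abel_inequality:
  fixes d u :: "nat \<Rightarrow> real"
  assumes antimono: "\<And>k. u (Suc k) \<le> u k"
    and nonneg: "\<And>k. 0 \<le> u k"
    and bound: "\<And>n. \<bar>\<Sum>k<n. d k\<bar> \<le> e"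
  shows "\<bar>\<Sum>k<n. d k * u k\<bar> \<le> e * u 0"
proof -
  define S where "S n = (\<Sum>k<n. d k)" for n
  have "(\<Sum>k<n. d k * u k) = u n * S n + (\<Sum>k<n. (u k - u (Suc k)) * S (Suc k))"
    by (induction n) (simp_all add: S_def algebra_simps)
  also have "\<bar>\<dots>\<bar> \<le> \<bar>u n * S n\<bar> + (\<Sum>k<n. \<bar>(u k - u (Suc k)) * S (Suc k)\<bar>)"
    by (rule order_trans[OF abs_triangle_ineq add_left_mono[OF sum_abs]])
  also have "\<dots> \<le> u n * e + (\<Sum>k<n. (u k - u (Suc k)) * e)"
    using antimono nonneg bound
    by (intro add_mono sum_mono) (auto simp: abs_mult S_def intro!: mult_left_mono
        simp del: sum.lessThan_Suc)
  also have "\<dots> = e * u 0"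
    unfolding sum_distrib_right[symmetric] sum_lessThan_telescope' by (simp add: algebra_simps)
  finally show ?thesis .
qed

text \<open>
  Abel's inequality, applied to a block of consecutive terms, bounds the block of the weighted
  series by the blocks of the convergent series \<open>c\<close>, independently of \<open>x\<close>.
\<close>
lemma Abel_test_uniform_limit:
  fixes c :: "nat \<Rightarrow> real" and u :: "nat \<Rightarrow> 'a \<Rightarrow> real"
  assumes "summable c"
    and antimono: "\<And>k x. x \<in> X \<Longrightarrow> u (Suc k) x \<le> u k x"
    and nonneg: "\<And>k x. x \<in> X \<Longrightarrow> 0 \<le> u k x"
    and le_1: "\<And>x. x \<in> X \<Longrightarrow> u 0 x \<le> 1"
    and sums: "\<And>x. x \<in> X \<Longrightarrow> (\<lambda>k. c k * u k x) sums F x"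
  shows "uniform_limit X (\<lambda>n x. \<Sum>k<n. c k * u k x) F sequentially"
  unfolding uniform_limit_sequentially_iff
proof (intro allI impI)
  fix e :: real assume "0 < e"
  \<comment> \<open>The bound is halved because only the non-strict inequality passes to the limit below.\<close>
  then have "0 < e/2" by simp
  then obtain N where N: "\<And>m n. m \<ge> N \<Longrightarrow> norm (\<Sum>k\<in>{m..<n}. c k) < e/2"
    using \<open>summable c\<close> unfolding summable_Cauchy by meson
  show "\<exists>N. \<forall>n\<ge>N. \<forall>x\<in>X. dist (\<Sum>k<n. c k * u k x) (F x) < e"
  proof (intro exI allI impI ballI)
    fix n x assume n: "N \<le> n" and x: "x \<in> X"
    have block: "\<bar>\<Sum>k<m. c (k + n) * u (k + n) x\<bar> \<le> e/2" for m
    proof -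
      have "\<bar>\<Sum>k<m. c (k + n)\<bar> \<le> e/2" for m
        using N[OF n, of "m + n"] sum.shift_bounds_nat_ivl[of c 0 n m]
        by (simp add: lessThan_atLeast0)
      then have "\<bar>\<Sum>k<m. c (k + n) * u (k + n) x\<bar> \<le> e/2 * u n x"
        using Abel_inequality[of "\<lambda>k. u (k + n) x" "\<lambda>k. c (k + n)" "e/2" m]
          antimono[OF x] nonneg[OF x] by simp
      also have "u n x \<le> 1"
        using antimono[OF x] le_1[OF x] by (induction n) (auto intro: order_trans)
      then have "e/2 * u n x \<le> e/2"
        using \<open>0 < e\<close> by simp
      finally show ?thesis .
    qed
    have "(\<lambda>k. c (k + n) * u (k + n) x) sums (F x - (\<Sum>k<n. c k * u k x))"
      by (rule sums_split_initial_segment[OF sums[OF x]])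
    then have "\<bar>F x - (\<Sum>k<n. c k * u k x)\<bar> \<le> e/2"
      unfolding sums_def using block
      by (intro tendsto_upperbound[OF tendsto_rabs]) (auto simp: eventually_sequentially)
    then show "dist (\<Sum>k<n. c k * u k x) (F x) < e"
      using \<open>0 < e\<close> by (simp add: dist_real_def abs_minus_commute)
  qed
qed

text \<open>
  The integrand is the derivative of \<open>sin\<^bsup>n+1\<^esup> x \<cdot> cos x\<close>, which vanishes at both ends of the
  interval.
\<close>
lemma sin_power_reduction:
  "((\<lambda>x. real (n + 1) * sin x ^ n - real (n + 2) * sin x ^ (n + 2)) has_integral 0) {0..pi/2}"
proof -
  have "((\<lambda>x. real (n + 1) * sin x ^ n - real (n + 2) * sin x ^ (n + 2)) has_integral
      (sin (pi/2) ^ (n + 1) * cos (pi/2) - sin 0 ^ (n + 1) * cos 0)) {0..pi/2}"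
  proof (rule fundamental_theorem_of_calculus)
    fix x :: real
    have cos2: "cos x * cos x = 1 - sin x * sin x"
      using sin_cos_squared_add[of x] by (simp add: power2_eq_square algebra_simps)
    have "((\<lambda>x. sin x ^ (n + 1) * cos x) has_real_derivative
        (real (n + 1) * sin x ^ n) * (cos x * cos x) - sin x ^ (n + 2)) (at x within {0..pi/2})"
      using DERIV_mult[OF DERIV_power[OF has_field_derivative_at_within[OF DERIV_sin], where n = "n + 1"]
          has_field_derivative_at_within[OF DERIV_cos], of x "{0..pi/2}"]
      by (simp add: algebra_simps)
    then show "((\<lambda>x. sin x ^ (n + 1) * cos x) has_vector_derivative
        real (n + 1) * sin x ^ n - real (n + 2) * sin x ^ (n + 2)) (at x within {0..pi/2})"
      unfolding cos2 has_real_derivative_iff_has_vector_derivative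
      by (simp add: algebra_simps)
  qed simp
  then show ?thesis by simp
qed

lemma wallis_integral_even:
  "((\<lambda>x. sin x ^ (2 * k)) has_integral pi/2 * (odd_product k / even_product k)) {0..pi/2}"
proof (induction k)
  case 0
  show ?case
    using has_integral_const_real[of "1::real" 0 "pi/2"]
    by (simp add: odd_product_def even_product_def)
next
  case (Suc k)
  let ?I = "pi/2 * (odd_product k / even_product k)"
  have "((\<lambda>x. real (2*k+1) * sin x ^ (2*k) -
        (real (2*k+1) * sin x ^ (2*k) - real (2*k+2) * sin x ^ (2*k+2)))
      has_integral real (2*k+1) * ?I - 0) {0..pi/2}"
    by (intro has_integral_diff has_integral_mult_right Suc.IH sin_power_reduction)
  then have "((\<lambda>x. real (2*k+2) * sin x ^ (2*k+2)) has_integral real (2*k+1) * ?I) {0..pi/2}"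
    by simp
  from has_integral_mult_right[OF this, of "1 / real (2*k+2)"]
  have "((\<lambda>x. sin x ^ (2*k+2)) has_integral real (2*k+1) / real (2*k+2) * ?I) {0..pi/2}"
    by (simp del: of_nat_add of_nat_mult)
  moreover have "odd_product (Suc k) = odd_product k * real (2*k+1)"
    "even_product (Suc k) = even_product k * real (2*k+2)"
    by (simp_all add: odd_product_def even_product_def)
  then have "real (2*k+1) / real (2*k+2) * ?I
      = pi/2 * (odd_product (Suc k) / even_product (Suc k))"
    by (simp add: ac_simps del: of_nat_add of_nat_mult)
  ultimately show ?case by simp
qed

lemma has_integral_reflect_midpoint:
  fixes g :: "real \<Rightarrow> 'a::banach"
  assumes "(g has_integral I) {0..b}"
  shows "((\<lambda>x. g (b - x)) has_integral I) {0..b}"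
proof -
  have "(\<lambda>x. b - x) ` {0..b} = {0..b}"
    using image_diff_atLeastAtMost[of b 0 b] by simp
  then show ?thesis
    using has_integral_affinity[of g I 0 b "-1" b] assms by (simp add: image_image)
qed

theorem theorem3:
  fixes f :: "real \<Rightarrow> real" and a :: "nat \<Rightarrow> real"
  assumes "\<And>x. x \<in> {0..1} \<Longrightarrow> (\<lambda>k. a (2 * k) * x ^ (2 * k)) sums f x"
  shows "(\<lambda>x. f (sin x)) integrable_on {0..pi/2}
    \<and> (\<lambda>x. f (cos x)) integrable_on {0..pi/2}
    \<and> summable (\<lambda>k. a (2 * Suc k) * (odd_product (Suc k) / even_product (Suc k)))
    \<and> integral {0..pi/2} (\<lambda>x. f (sin x)) = integral {0..pi/2} (\<lambda>x. f (cos x))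
    \<and> integral {0..pi/2} (\<lambda>x. f (cos x)) =
        pi/2 * a 0 + pi/2 * (\<Sum>k. a (2 * Suc k) * (odd_product (Suc k) / even_product (Suc k)))"
proof -
  let ?r = "\<lambda>k. odd_product k / even_product k"
  have sin_01: "sin x \<in> {0..1}" if "x \<in> {0..pi/2}" for x
    using that by (auto intro!: sin_ge_zero)
  have "summable (\<lambda>k. a (2 * k))"
    using assms[of 1] by (auto simp: sums_iff)
  then have "uniform_limit {0..pi/2} (\<lambda>n x. \<Sum>k<n. a (2 * k) * sin x ^ (2 * k))
      (\<lambda>x. f (sin x)) sequentially"
  proof (rule Abel_test_uniform_limit)
    show "sin x ^ (2 * Suc k) \<le> sin x ^ (2 * k)" if "x \<in> {0..pi/2}" for k x
      using sin_01[OF that] by (intro power_decreasing) auto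
  qed (use sin_01 assms in auto)
  then obtain I J where
      I: "\<And>n. ((\<lambda>x. \<Sum>k<n. a (2 * k) * sin x ^ (2 * k)) has_integral I n) {0..pi/2}"
    and J: "((\<lambda>x. f (sin x)) has_integral J) {0..pi/2}"
    and lim: "I \<longlonglongrightarrow> J"
    by (rule uniform_limit_integral) (auto intro!: continuous_intros)
  have "I n = (\<Sum>k<n. a (2 * k) * (pi/2 * ?r k))" for n
    by (intro has_integral_unique[OF I] has_integral_sum has_integral_mult_right
        wallis_integral_even) simp
  then have "(\<lambda>k. a (2 * k) * (pi/2 * ?r k)) sums J"
    using lim unfolding sums_def by presburger
  from sums_mult[OF this, of "2/pi"]
  have "(\<lambda>k. a (2 * k) * ?r k) sums (2/pi * J)"
    by (simp add: field_simps)
  then have tail: "(\<lambda>k. a (2 * Suc k) * ?r (Suc k)) sums (2/pi * J - a 0)"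
    by (subst sums_Suc_iff) (simp add: odd_product_def even_product_def)
  have J_cos: "((\<lambda>x. f (cos x)) has_integral J) {0..pi/2}"
    using has_integral_reflect_midpoint[OF J] by (simp add: sin_diff)
  have "J = pi/2 * a 0 + pi/2 * (\<Sum>k. a (2 * Suc k) * ?r (Suc k))"
    unfolding sums_unique[OF tail, symmetric] by (simp add: field_simps)
  then show ?thesis
    using J J_cos sums_summable[OF tail] by (auto simp: integral_unique)
qed

end
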